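(* Let $F$ be the distribution of buyers' types on $[a,b]$ and let $\mathcal{C}$ be a constraint set with associated set of $1$-separating menus $\mathcal{C}_1$. Suppose that $F(m)m$ is a strictly convex function on $[a,b]$ and that $\mathcal{C}$ is regular. Assume that the set of all $1$-separating menus $\mathcal{C}_1$ is a compact subset of $\mathbb{R}^2$ (identifying $\{(p,q)\}$ with $(p,q)$). Then there is an optimal $1$-separating menu. In addition, the optimal $1$-separating menu $\{(p,q)\}$ is maximal in $\mathcal{C}_1$: for every $\{(p',q')\}\in\mathcal{C}_1$ such that $(p',q')\neq(p,q)$ we have $p>p'$ or $q>q'$.
   Context: Buyers. There is a continuum of buyers with types $m$ distributed according to a continuous cumulative distribution function $F$ with a density $f$, supported on an interval $[a,b]\subseteq[0,\infty)$. A type $m$ buyer gets utility $mq-p$ from a price-quality pair $(p,q)$ and $0$ from not buying. Menus. A menu is a finite set $C=\{(p_1,q_1),\ldots,(p_k,q_k)\}$ of price-quality pairs (nonnegative numbers), labeled without loss of generality so that $p_1\le\cdots\le p_k$. The demand for $(p_i,q_i)$ is the mass of buyers choosing it, $$D_i(C)=\int_a^b 1\{mq_i-p_i\ge 0\}\,1\{mq_i-p_i=\max_{(p_j,q_j)\in C}(mq_j-p_j)\}\,F(dm)$$ (a buyer indifferent between several best pairs chooses the one with the highest index; since $F$ has no atoms this is immaterial), and the total transaction value is $\pi(C)=\sum_{(p_i,q_i)\in C}p_iD_i(C)$. Constraint set. A constraint set $\mathcal{C}$ is a nonempty set of menus (the menus from which the platform can choose). A menu in $\mathcal{C}$ is optimal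 if it maximizes $\pi$ over $\mathcal{C}$. Let $\mathcal{C}_p=\{C\in\mathcal{C}: D_i(C)>0 \text{ for all } (p_i,q_i)\in C\}$. A menu $C\in\mathcal{C}_p$ is $k$-separating if it contains exactly $k$ different price-quality pairs; $\mathcal{C}_1\subseteq\mathcal{C}_p$ is the set of all $1$-separating menus. Regularity. For a quality $q>0$ let $p^M(q)=\inf\operatorname{argmax}_{p\ge0}\,p\,(1-F(p/q))$. The constraint set $\mathcal{C}$ is regular if: (i) whenever $C=\{(p_1,q_1),\ldots,(p_k,q_k)\}\in\mathcal{C}_p$ (with $p_1\le\cdots\le p_k$), there exists $\{(p,q)\}\in\mathcal{C}_1$ such that $p\ge p_k$ and $q\ge q_k$; and (ii) if $\{(p,q)\}\in\mathcal{C}_1$ is such that $p\ge p'$ for all $\{(p',q')\}\in\mathcal{C}_1$, then $p\le p^M(q)$.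
   Formalization: Added: C_1 is nonempty, and removing pairs nobody buys from a menu in the constraint set leaves a menu in it (if any pair remains); the claim fails without these. Maximality is asserted for some optimal 1-separating menu, since with ties not every optimal one is maximal. *)

theory Defs
  imports "HOL-Probability.Probability"
begin

text \<open>
  The library has no strict version of \<^const>\<open>convex_on\<close>; this one is for functions on the line.
\<close>

definition strictly_convex_on :: "real set \<Rightarrow> (real \<Rightarrow> real) \<Rightarrow> bool" where
  "strictly_convex_on S g \<longleftrightarrow> convex S \<and>
     (\<forall>x\<in>S. \<forall>y\<in>S. \<forall>u>0. \<forall>v>0. x \<noteq> y \<longrightarrow> u + v = 1 \<longrightarrow>
        g (u * x + v * y) < u * g x + v * g y)"

text \<open>
  A price-quality pair \<open>(p, q)\<close> is an element of \<^typ>\<open>real \<times> real\<close>, the price first.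
  Menus are sets, hence carry no enumeration; where the order of prices matters
  (in \<open>regular\<close> below) the pair of highest price is singled out explicitly.
\<close>

definition utility :: "real \<Rightarrow> real \<times> real \<Rightarrow> real" where
  "utility m x = m * snd x - fst x"

definition is_menu :: "(real \<times> real) set \<Rightarrow> bool" where
  "is_menu C \<longleftrightarrow> finite C \<and> (\<forall>(p, q) \<in> C. 0 \<le> p \<and> 0 \<le> q)"

definition constraint_set :: "(real \<times> real) set set \<Rightarrow> bool" where
  "constraint_set \<C> \<longleftrightarrow> \<C> \<noteq> {} \<and> (\<forall>C\<in>\<C>. is_menu C)"

text \<open>
  \<open>M\<close> is the law of the buyers' types, concentrated on \<open>{a..b}\<close>.  An indifferent buyer is counted
  for every best pair of the menu.  Two distinct pairs tie for at most one type, so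
  for an atomless \<open>M\<close> the tie-breaking rule does not matter.
\<close>

definition demand ::
    "real measure \<Rightarrow> real \<Rightarrow> real \<Rightarrow> (real \<times> real) set \<Rightarrow> real \<times> real \<Rightarrow> real" where
  "demand M a b C x =
     measure M {m \<in> {a..b}. 0 \<le> utility m x \<and> utility m x = Max (utility m ` C)}"

definition transaction_value :: "real measure \<Rightarrow> real \<Rightarrow> real \<Rightarrow> (real \<times> real) set \<Rightarrow> real" where
  "transaction_value M a b C = (\<Sum>x\<in>C. fst x * demand M a b C x)"

definition optimal_menu ::
    "real measure \<Rightarrow> real \<Rightarrow> real \<Rightarrow> (real \<times> real) set set \<Rightarrow> (real \<times> real) set \<Rightarrow> bool" where
  "optimal_menu M a b \<C> C \<longleftrightarrow> is_arg_max (transaction_value M a b) (\<lambda>C'. C' \<in> \<C>) C"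

definition positive_menus ::
    "real measure \<Rightarrow> real \<Rightarrow> real \<Rightarrow> (real \<times> real) set set \<Rightarrow> (real \<times> real) set set" where
  "positive_menus M a b \<C> = {C \<in> \<C>. \<forall>x\<in>C. 0 < demand M a b C x}"

definition separating_menus ::
    "real measure \<Rightarrow> real \<Rightarrow> real \<Rightarrow> (real \<times> real) set set \<Rightarrow> nat \<Rightarrow> (real \<times> real) set set" where
  "separating_menus M a b \<C> k = {C \<in> positive_menus M a b \<C>. card C = k}"

text \<open>The 1-separating menus, each identified with its only pair.\<close>

definition single_pairs ::
    "real measure \<Rightarrow> real \<Rightarrow> real \<Rightarrow> (real \<times> real) set set \<Rightarrow> (real \<times> real) set" where
  "single_pairs M a b \<C> = {x. {x} \<in> separating_menus M a b \<C> 1}"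

text \<open>The part of a menu that somebody buys.\<close>

definition sold_part ::
    "real measure \<Rightarrow> real \<Rightarrow> real \<Rightarrow> (real \<times> real) set \<Rightarrow> (real \<times> real) set" where
  "sold_part M a b C = {x \<in> C. 0 < demand M a b C x}"

text \<open>Only meaningful for \<open>q > 0\<close>.\<close>

definition monopoly_price :: "real measure \<Rightarrow> real \<Rightarrow> real" where
  "monopoly_price M q =
     Inf {p. is_arg_max (\<lambda>p. p * (1 - cdf M (p / q))) (\<lambda>p. 0 \<le> p) p}"

text \<open>
  In the second condition \<open>q > 0\<close> is required because the monopoly price is only defined then.
  A pair of quality \<open>0\<close> with positive demand has price \<open>0\<close>.
\<close>

definition regular ::
    "real measure \<Rightarrow> real \<Rightarrow> real \<Rightarrow> (real \<times> real) set set \<Rightarrow> bool" where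
  "regular M a b \<C> \<longleftrightarrow>
     (\<forall>C \<in> positive_menus M a b \<C>. \<forall>(pk, qk) \<in> C. (\<forall>(p', q') \<in> C. p' \<le> pk) \<longrightarrow>
        (\<exists>(p, q) \<in> single_pairs M a b \<C>. pk \<le> p \<and> qk \<le> q)) \<and>
     (\<forall>(p, q) \<in> single_pairs M a b \<C>.
        0 < q \<longrightarrow> (\<forall>(p', q') \<in> single_pairs M a b \<C>. p' \<le> p) \<longrightarrow> p \<le> monopoly_price M q)"

end

theory Submission
  imports Defs
begin

text \<open>
  Write \<open>F\<close> for the distribution function, \<open>R m = m (1 - F m)\<close> for the revenue per unit of quality and
  \<open>V (p, q) = p (1 - F (p / q)) = q R (p / q)\<close> for the value of a single pair.  Strict convexity of
  \<open>F m m\<close> makes \<open>R\<close> concave on \<open>[0, b]\<close>.  In a menu all of whose pairs are sold, let \<open>t\<close> be the most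
  expensive pair and \<open>s\<close> the second most expensive one.  Dropping \<open>t\<close> costs at most
  \<open>(p\<^sub>t - p\<^sub>s) (1 - F m) = (q\<^sub>t - q\<^sub>s) R m\<close>, where the type \<open>m = (p\<^sub>t - p\<^sub>s) / (q\<^sub>t - q\<^sub>s)\<close> is indifferent
  between \<open>s\<close> and \<open>t\<close>; as \<open>p\<^sub>t / q\<^sub>t\<close> is the average of \<open>p\<^sub>s / q\<^sub>s\<close> and \<open>m\<close> with weights proportional to
  \<open>q\<^sub>s\<close> and \<open>q\<^sub>t - q\<^sub>s\<close>, induction and Jensen's inequality bound the value of the menu by \<open>V t\<close>.

  Let \<open>m\<^sub>0\<close> maximize \<open>R\<close>.  Then \<open>V\<close> is monotone in both arguments below any pair with \<open>p \<le> q m\<^sub>0\<close>.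
  Let \<open>(p\<^sup>*, q\<^sup>*)\<close> be a 1-separating pair of maximal price, so that \<open>p\<^sup>* \<le> q\<^sup>* m\<^sub>0\<close> by regularity.  A
  1-separating pair \<open>(p, q)\<close> lies below \<open>(p\<^sup>*, q\<^sup>*)\<close> if \<open>q \<le> q\<^sup>*\<close>, and otherwise
  \<open>p \<le> p\<^sup>* \<le> q\<^sup>* m\<^sub>0 \<le> q m\<^sub>0\<close>.  Either way some 1-separating pair above \<open>(p, q)\<close> is at least as good
  as everything below \<open>(p, q)\<close>.  Hence a maximizer of \<open>V\<close> among the 1-separating pairs is optimal, and
  one with the largest \<open>p + q\<close> is maximal.
\<close>

text \<open>As \<open>0 / 0 = 0\<close>, the value of the pair \<open>(0, 0)\<close> is the correct one, 0.\<close>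

definition single_value :: "real measure \<Rightarrow> real \<times> real \<Rightarrow> real" where
  "single_value M x = fst x * (1 - cdf M (fst x / snd x))"

text \<open>Bounding every alternative by the utility of \<open>x\<close>, rather than equating it
  with a \<open>Max\<close>, makes antitonicity in the menu and closedness immediate.\<close>

definition buyers :: "real \<Rightarrow> real \<Rightarrow> (real \<times> real) set \<Rightarrow> real \<times> real \<Rightarrow> real set" where
  "buyers a b C x = {m \<in> {a..b}. 0 \<le> utility m x \<and> (\<forall>y\<in>C. utility m y \<le> utility m x)}"

lemma demand_eq_measure_buyers:
  assumes "finite C" "x \<in> C"
  shows "demand M a b C x = measure M (buyers a b C x)"
proof -
  have "utility m x = Max (utility m ` C) \<longleftrightarrow> (\<forall>y\<in>C. utility m y \<le> utility m x)" for m
    using assms by (subst eq_Max_iff) auto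
  then show ?thesis by (simp add: demand_def buyers_def)
qed

lemma buyers_antimono: "C' \<subseteq> C \<Longrightarrow> buyers a b C x \<subseteq> buyers a b C' x"
  by (auto simp: buyers_def)

lemma closed_buyers: "closed (buyers a b C x)"
proof -
  have *: "closed {m. utility m y \<le> utility m x}" for y
    unfolding utility_def by (intro closed_Collect_le continuous_intros)
  have "closed {m. 0 \<le> utility m x}"
    unfolding utility_def by (intro closed_Collect_le continuous_intros)
  moreover have "buyers a b C x
      = {a..b} \<inter> {m. 0 \<le> utility m x} \<inter> (\<Inter>y\<in>C. {m. utility m y \<le> utility m x})"
    by (auto simp: buyers_def)
  ultimately show ?thesis using * by (auto intro!: closed_Int closed_INT)
qed

section \<open>Distribution function of the types\<close>

locale type_law = real_distribution M for M :: "real measure" +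
  fixes a b :: real
  assumes interval: "0 \<le> a" "a < b"
    and atomless: "\<And>x. measure M {x} = 0"
    and supported: "measure M {a..b} = 1"
    and strictly_convex: "strictly_convex_on {a..b} (\<lambda>m. cdf M m * m)"
begin

lemma continuous_cdf: "isCont (cdf M) x"
  using atomless isCont_cdf by blast

lemma cdf_mono: "x \<le> y \<Longrightarrow> cdf M x \<le> cdf M y"
  by (rule cdf_nondecreasing)

lemma cdf_eq_1: "b \<le> x \<Longrightarrow> cdf M x = 1"
proof -
  assume "b \<le> x"
  then have "measure M {a..b} \<le> measure M {..x}" by (intro finite_measure_mono) auto
  then show ?thesis using supported prob_le_1[of "{..x}"] by (simp add: cdf_def)
qed

lemma measure_atLeast: "measure M {x..} = 1 - cdf M x"
proof -
  have "measure M {x..} = measure M ({x} \<union> {x<..})"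
    by (rule arg_cong[where f = "measure M"]) auto
  also have "\<dots> = measure M {x<..}"
    using atomless[of x] by (subst finite_measure_Union) auto
  also have "\<dots> = measure M (UNIV - {..x})"
    by (rule arg_cong[where f = "measure M"]) auto
  also have "\<dots> = 1 - cdf M x"
    using prob_compl[of "{..x}"] by (simp add: cdf_def)
  finally show ?thesis .
qed

lemma measure_Int_support:
  assumes "A \<in> sets borel"
  shows "measure M ({a..b} \<inter> A) = measure M A"
proof -
  have "measure M (UNIV - {a..b}) = 0"
    using prob_compl[of "{a..b}"] supported by simp
  then have "measure M (A - {a..b}) = 0"
    using assms finite_measure_mono[of "A - {a..b}" "UNIV - {a..b}"]
    by (simp add: measure_le_0_iff Diff_mono)
  moreover have "measure M A = measure M ({a..b} \<inter> A) + measure M (A - {a..b})"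
    using assms by (subst finite_measure_Union[symmetric]) (auto intro!: arg_cong[where f = "measure M"])
  ultimately show ?thesis by simp
qed

lemma cdf_eq_0: "x \<le> a \<Longrightarrow> cdf M x = 0"
proof -
  assume "x \<le> a"
  have "measure M {a..} = 1"
    using measure_Int_support[of "{a..}"] supported
    by (metis atLeast_borel atLeastAtMost_def inf.absorb_iff1 inf_le1)
  then have "cdf M a = 0" using measure_atLeast[of a] by simp
  then show ?thesis using cdf_mono[OF \<open>x \<le> a\<close>] cdf_nonneg[of x] by simp
qed

lemma cdf_le_1: "cdf M x \<le> 1"
  by (rule cdf_bounded_prob)

lemma cdf_mult_mono: "0 \<le> x \<Longrightarrow> x \<le> y \<Longrightarrow> cdf M x * x \<le> cdf M y * y"
  by (intro mult_mono cdf_mono cdf_nonneg) auto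

lemma convex_cdf_mult: "convex_on {0..b} (\<lambda>m. cdf M m * m)"
proof (rule convex_onI)
  fix t x y :: real
  assume t: "0 < t" "t < 1" and x: "x \<in> {0..b}" and y: "y \<in> {0..b}"
  \<comment> \<open>The function vanishes on \<open>[0, a]\<close> and is increasing, so arguments may be moved up to \<open>a\<close>.\<close>
  define x' y' where "x' = max a x" and "y' = max a y"
  have x': "x' \<in> {a..b}" "x \<le> x'" and y': "y' \<in> {a..b}" "y \<le> y'"
    using x y interval by (auto simp: x'_def y'_def)
  have eqs: "cdf M x' * x' = cdf M x * x" "cdf M y' * y' = cdf M y * y"
    using cdf_eq_0 by (auto simp: x'_def y'_def max_def)
  let ?g = "\<lambda>m. cdf M m * m"
  have "?g ((1 - t) * x + t * y) \<le> ?g ((1 - t) * x' + t * y')"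
    using t x y x' y' by (intro cdf_mult_mono add_mono mult_left_mono) auto
  also have "\<dots> \<le> (1 - t) * ?g x' + t * ?g y'"
  proof (cases "x' = y'")
    case True
    then show ?thesis by (simp add: algebra_simps)
  next
    case False
    then show ?thesis
      using strictly_convex x' y' t unfolding strictly_convex_on_def
      by (intro less_imp_le) auto
  qed
  finally show "?g ((1 - t) *\<^sub>R x + t *\<^sub>R y) \<le> (1 - t) * ?g x + t * ?g y"
    by (simp add: eqs)
qed (rule convex_real_interval)

section \<open>Revenue per unit of quality\<close>

definition revenue :: "real \<Rightarrow> real" where
  "revenue m = m * (1 - cdf M m)"

text \<open>\<open>revenue\<close> is the identity minus the function of
  \<open>convex_cdf_mult\<close>.\<close>

lemma concave_revenue:
  assumes "x \<in> {0..b}" "y \<in> {0..b}" "0 \<le> u" "0 \<le> v" "u + v = 1"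
  shows "u * revenue x + v * revenue y \<le> revenue (u * x + v * y)"
proof -
  have u: "u = 1 - v" using assms by simp
  have "(u * x + v * y) * cdf M (u * x + v * y) \<le> u * (x * cdf M x) + v * (y * cdf M y)"
    using convex_onD[OF convex_cdf_mult, of v x y] assms by (simp add: u mult.commute)
  then show ?thesis by (simp add: revenue_def right_diff_distrib)
qed

lemma obtain_revenue_max:
  obtains m where "m \<in> {0..b}" "\<And>x. 0 \<le> x \<Longrightarrow> revenue x \<le> revenue m"
proof -
  have "continuous_on {0..b} revenue"
    unfolding revenue_def
    by (intro continuous_intros continuous_at_imp_continuous_on ballI continuous_cdf)
  then obtain m where m: "m \<in> {0..b}" "\<And>x. x \<in> {0..b} \<Longrightarrow> revenue x \<le> revenue m"
    using continuous_attains_sup[of "{0..b}" revenue] interval by auto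
  have "revenue x \<le> revenue m" if "0 \<le> x" for x
  proof (cases "x \<le> b")
    \<comment> \<open>Beyond \<open>b\<close> nobody buys, so the revenue is 0, as it is at price
      0.\<close>
    case False
    then have "revenue x = revenue 0" using cdf_eq_1 by (simp add: revenue_def)
    then show ?thesis using m(2)[of 0] interval by simp
  qed (use m(2) that in auto)
  then show thesis using that m(1) by blast
qed

text \<open>\<open>y\<close> is a weighted average of \<open>x\<close> and the maximizer
  \<open>m\<close>, so by concavity its revenue is at least an average of two numbers that are both
  at least \<open>revenue x\<close>.\<close>

lemma revenue_mono_below_max:
  assumes m: "m \<in> {0..b}" "\<And>x. 0 \<le> x \<Longrightarrow> revenue x \<le> revenue m"
    and x: "0 \<le> x" "x \<le> y" "y \<le> m"
  shows "revenue x \<le> revenue y"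
proof (cases "x = m")
  case False
  define v where "v = (y - x) / (m - x)"
  have "v * (m - x) = y - x" using x False by (simp add: v_def)
  then have "(1 - v) * x + v * m = y" by (simp add: algebra_simps)
  moreover have "0 \<le> v" "v \<le> 1" using x False by (auto simp: v_def)
  ultimately have v: "0 \<le> v" "v \<le> 1" "(1 - v) * x + v * m = y" by auto
  have "revenue x = (1 - v) * revenue x + v * revenue x" by (simp add: algebra_simps)
  also have "\<dots> \<le> (1 - v) * revenue x + v * revenue m"
    using m x v by (intro add_left_mono mult_left_mono) auto
  also have "\<dots> \<le> revenue y"
    using concave_revenue[of x m "1 - v" v] m x v by auto
  finally show ?thesis .
qed (use x in auto)

section \<open>Value of a single pair\<close>

lemma single_value_eq_revenue:
  "0 < q \<Longrightarrow> single_value M (p, q) = q * revenue (p / q)"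
  by (simp add: single_value_def revenue_def)

lemma single_value_bounds:
  assumes "0 \<le> fst x"
  shows "0 \<le> single_value M x" "single_value M x \<le> fst x"
  using assms cdf_nonneg cdf_le_1 by (auto simp: single_value_def intro!: mult_left_le)

text \<open>Two moves: raising the quality at a fixed price lowers the threshold type and raises
  demand; raising the price at quality \<open>q'\<close> moves the price per unit towards the
  maximizer \<open>m\<close>.\<close>

lemma single_value_mono:
  assumes m: "m \<in> {0..b}" "\<And>x. 0 \<le> x \<Longrightarrow> revenue x \<le> revenue m"
    and p: "0 \<le> p" "p \<le> p'" "p' \<le> q' * m" and q: "0 \<le> q" "q \<le> q'" "q = 0 \<Longrightarrow> p = 0"
  shows "single_value M (p, q) \<le> single_value M (p', q')"
proof (cases "p = 0")
  case True
  then show ?thesis using single_value_bounds(1)[of "(p', q')"] p by (simp add: single_value_def)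
next
  case False
  then have pos: "0 < p" "0 < q" "0 < q'" using p q by (auto simp: less_le)
  have "p / q' \<le> p / q" using pos q by (intro divide_left_mono) auto
  then have "single_value M (p, q) \<le> single_value M (p, q')"
    using pos cdf_mono by (simp add: single_value_def)
  moreover have "revenue (p / q') \<le> revenue (p' / q')"
  proof (rule revenue_mono_below_max[OF m])
    show "0 \<le> p / q'" "p / q' \<le> p' / q'" using p pos by (auto intro: divide_right_mono)
    show "p' / q' \<le> m" using p(3) pos by (simp add: pos_divide_le_eq mult.commute[of m])
  qed
  then have "single_value M (p, q') \<le> single_value M (p', q')"
    using pos by (simp add: single_value_eq_revenue)
  ultimately show ?thesis by simp
qed

text \<open>\<open>q * m\<close> is itself a maximizer of the profit, so the infimum of all
  maximizers cannot exceed it.\<close>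

lemma monopoly_price_le:
  assumes m: "m \<in> {0..b}" "\<And>x. 0 \<le> x \<Longrightarrow> revenue x \<le> revenue m" and q: "0 < q"
  shows "monopoly_price M q \<le> q * m"
  unfolding monopoly_price_def
proof (rule cInf_lower)
  have "p * (1 - cdf M (p / q)) \<le> q * m * (1 - cdf M (q * m / q))" if "0 \<le> p" for p
  proof -
    have "q * revenue (p / q) \<le> q * revenue m"
      using m(2)[of "p / q"] that q by (intro mult_left_mono) auto
    then show ?thesis using q by (simp add: revenue_def mult.assoc)
  qed
  then show "q * m \<in> {p. is_arg_max (\<lambda>p. p * (1 - cdf M (p / q))) ((\<le>) 0) p}"
    using m q by (auto simp: is_arg_max_linorder)
  show "bdd_below {p. is_arg_max (\<lambda>p. p * (1 - cdf M (p / q))) ((\<le>) 0) p}"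
    by (auto simp: is_arg_max_linorder intro!: bdd_belowI[of _ 0])
qed

text \<open>At quality 0 the quotient has no limit in general, but the price is 0 there and the
  value is squeezed between 0 and the price.\<close>

lemma continuous_on_single_value:
  assumes "\<And>x. x \<in> S \<Longrightarrow> 0 \<le> fst x" "\<And>x. x \<in> S \<Longrightarrow> snd x = 0 \<Longrightarrow> fst x = 0"
  shows "continuous_on S (single_value M)"
  unfolding continuous_on_eq_continuous_within
proof
  fix x assume x: "x \<in> S"
  show "continuous (at x within S) (single_value M)"
  proof (cases "snd x = 0")
    case False
    have "isCont (\<lambda>x. cdf M (fst x / snd x)) x"
      using False by (intro isCont_o2[OF _ continuous_cdf] continuous_intros)
    then have "isCont (\<lambda>x. fst x * (1 - cdf M (fst x / snd x))) x"
      by (intro continuous_intros)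
    then show ?thesis
      by (simp add: single_value_def[abs_def] continuous_at_imp_continuous_within)
  next
    case True
    then have "fst x = 0" using assms x by blast
    have "((\<lambda>y. fst y) \<longlongrightarrow> 0) (at x within S)"
      using tendsto_fst[OF tendsto_ident_at, of x S] \<open>fst x = 0\<close> by simp
    then have "(single_value M \<longlongrightarrow> 0) (at x within S)"
      by (intro tendsto_sandwich[of "\<lambda>_. 0" "single_value M" _ fst] tendsto_const)
        (auto simp: eventually_at_filter single_value_bounds assms)
    then show ?thesis using \<open>fst x = 0\<close> by (simp add: continuous_within single_value_def)
  qed
qed

section \<open>Demand in menus all of whose pairs are sold\<close>

lemma buyers_measurable [measurable]: "buyers a b C x \<in> sets borel"
  using closed_buyers by simp

lemma demand_antimono:
  assumes "finite C" "C' \<subseteq> C" "x \<in> C'"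
  shows "demand M a b C x \<le> demand M a b C' x"
proof -
  have "finite C'" "x \<in> C" using assms finite_subset by auto
  then show ?thesis
    using assms by (simp add: demand_eq_measure_buyers finite_measure_mono buyers_antimono)
qed

text \<open>The hypothesis excludes \<open>(p, 0)\<close> with \<open>p > 0\<close>: nobody buys it,
  but since \<open>p / 0 = 0\<close> its \<open>single_value\<close> is \<open>p\<close>.\<close>

lemma transaction_value_singleton:
  assumes "0 < snd x \<or> x = (0, 0)"
  shows "transaction_value M a b {x} = single_value M x"
proof (cases "x = (0, 0)")
  case False
  then have "0 < snd x" using assms by blast
  then have "buyers a b {x} x = {a..b} \<inter> {fst x / snd x..}"
    by (auto simp: buyers_def utility_def field_simps)
  then have "measure M (buyers a b {x} x) = 1 - cdf M (fst x / snd x)"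
    by (simp only: measure_Int_support[OF atLeast_borel] measure_atLeast)
  then show ?thesis
    by (simp add: transaction_value_def single_value_def demand_eq_measure_buyers)
qed (simp add: transaction_value_def single_value_def)

text \<open>The endpoints are null, so a set of positive mass contains another type. The strict
  bound makes this type positive even if \<open>a = 0\<close>.\<close>

lemma obtain_interior_buyer:
  assumes "finite C" "x \<in> C" "0 < demand M a b C x"
  obtains m where "m \<in> buyers a b C x" "a < m" "m < b"
proof -
  have "\<not> buyers a b C x \<subseteq> {a, b}"
  proof
    assume "buyers a b C x \<subseteq> {a, b}"
    then have "measure M (buyers a b C x) \<le> measure M {a, b}"
      by (intro finite_measure_mono) auto
    also have "\<dots> \<le> measure M {a} + measure M {b}"
      using measure_Un_le[of "{a}" M "{b}"] by (simp add: insert_commute)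
    finally show False using assms atomless by (simp add: demand_eq_measure_buyers)
  qed
  then obtain m where "m \<in> buyers a b C x" "m \<noteq> a" "m \<noteq> b" by blast
  then show thesis using that[of m] by (auto simp: buyers_def)
qed

text \<open>Membership in the constraint set is left out because the induction passes to submenus,
  which may lie outside it.\<close>

definition sold_out :: "(real \<times> real) set \<Rightarrow> bool" where
  "sold_out C \<longleftrightarrow> is_menu C \<and> (\<forall>x\<in>C. 0 < demand M a b C x)"

lemma sold_out_subset:
  assumes "sold_out C" "C' \<subseteq> C"
  shows "sold_out C'"
  using assms demand_antimono[of C C'] finite_subset[of C' C]
  unfolding sold_out_def is_menu_def by (meson less_le_trans subsetD)

lemma sold_out_nonneg:
  assumes "sold_out C" "x \<in> C"
  shows "0 \<le> fst x" "0 \<le> snd x"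
  using assms by (auto simp: sold_out_def is_menu_def)

lemma sold_out_zero_quality:
  assumes C: "sold_out C" "x \<in> C" and "snd x = 0"
  shows "fst x = 0"
proof -
  obtain m where "m \<in> buyers a b C x"
    using obtain_interior_buyer C unfolding sold_out_def is_menu_def by metis
  then show ?thesis
    using assms sold_out_nonneg[OF C] by (auto simp: buyers_def utility_def)
qed

text \<open>For a buyer \<open>m\<close> of \<open>x\<close> and a buyer \<open>n\<close> of
  \<open>y\<close>, the price difference lies between \<open>m\<close> and \<open>n\<close> times
  the quality difference. Both types are positive, so the two differences have the same sign and
  vanish together.\<close>

lemma sold_out_order:
  assumes C: "sold_out C" "x \<in> C" "y \<in> C" "x \<noteq> y" and le: "fst x \<le> fst y"
  shows "fst x < fst y" "snd x < snd y"
proof -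
  obtain m where m: "m \<in> buyers a b C x" "a < m"
    using obtain_interior_buyer C unfolding sold_out_def is_menu_def by metis
  obtain n where n: "n \<in> buyers a b C y" "a < n"
    using obtain_interior_buyer C unfolding sold_out_def is_menu_def by metis
  have "m * snd y - fst y \<le> m * snd x - fst x" "n * snd x - fst x \<le> n * snd y - fst y"
    using m n C by (auto simp: buyers_def utility_def)
  then have *: "m * (snd y - snd x) \<le> fst y - fst x" "fst y - fst x \<le> n * (snd y - snd x)"
    by (auto simp: algebra_simps)
  have pos: "0 < m" "0 < n" using m n interval by auto
  have q: "snd x \<le> snd y"
    using *(2) le pos by (metis diff_ge_0_iff_ge order_trans zero_le_mult_iff not_less)
  show less: "fst x < fst y"
  proof (rule ccontr)
    assume "\<not> fst x < fst y"
    then have "fst x = fst y" using le by simp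
    then have "snd y \<le> snd x" using *(1) pos by (simp add: mult_le_0_iff)
    then show False using q \<open>fst x = fst y\<close> \<open>x \<noteq> y\<close> by (simp add: prod_eq_iff)
  qed
  then show "snd x < snd y" using * q by (cases "snd x = snd y") auto
qed

section \<open>Bounding a menu by its most expensive pair\<close>

text \<open>The extra term is \<open>(q' - q) * revenue m\<close> for the indifferent type
  \<open>m\<close>, so for \<open>q > 0\<close> the claim is Jensen's inequality times
  \<open>q'\<close>. The bounds with \<open>b\<close> place \<open>p / q\<close> and
  \<open>m\<close> where \<open>revenue\<close> is concave.\<close>

lemma single_value_Jensen:
  assumes s: "0 \<le> p" "0 \<le> q" "q = 0 \<Longrightarrow> p = 0" "p \<le> q * b"
    and t: "p \<le> p'" "q < q'" "p' - p \<le> (q' - q) * b"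
  shows "single_value M (p, q) + (p' - p) * (1 - cdf M ((p' - p) / (q' - q)))
    \<le> single_value M (p', q')"
proof (cases "q = 0")
  case True
  then show ?thesis using s by (simp add: single_value_def)
next
  case False
  then have q: "0 < q" "0 < q'" using s t by auto
  define m where "m = (p' - p) / (q' - q)"
  define u v where "u = q / q'" and "v = (q' - q) / q'"
  have "u * revenue (p / q) + v * revenue m \<le> revenue (u * (p / q) + v * m)"
    using q s t interval
    by (intro concave_revenue) (auto simp: u_def v_def m_def field_simps)
  moreover have "u * (p / q) + v * m = p' / q'"
    using q t by (simp add: u_def v_def m_def add_divide_distrib[symmetric])
  ultimately have "q' * (u * revenue (p / q) + v * revenue m) \<le> q' * revenue (p' / q')"
    using q by (intro mult_left_mono) auto
  moreover have "q' * (u * revenue (p / q) + v * revenue m)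
      = q * revenue (p / q) + (q' - q) * revenue m"
    using q by (simp add: u_def v_def distrib_left)
  moreover have "(q' - q) * revenue m = (p' - p) * (1 - cdf M m)"
    using t by (simp add: revenue_def m_def)
  ultimately show ?thesis using q by (simp add: single_value_eq_revenue m_def[symmetric])
qed

text \<open>Without \<open>t\<close> its buyers turn to \<open>s\<close>, and no remaining pair
  loses demand. So each buyer of \<open>t\<close> costs at most the price difference, and only types
  from the indifferent one upwards buy \<open>t\<close>.\<close>

lemma transaction_value_drop_top:
  assumes C: "sold_out C" "t \<in> C" "\<And>x. x \<in> C \<Longrightarrow> fst x \<le> fst t"
    and s: "s \<in> C - {t}" "\<And>x. x \<in> C - {t} \<Longrightarrow> fst x \<le> fst s"
  shows "transaction_value M a b C \<le> transaction_value M a b (C - {t})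
    + (fst t - fst s) * (1 - cdf M ((fst t - fst s) / (snd t - snd s)))"
proof -
  define m where "m = (fst t - fst s) / (snd t - snd s)"
  define C' where "C' = C - {t}"
  let ?D = "\<lambda>x. demand M a b C x"
  let ?D' = "\<lambda>x. demand M a b C' x"
  have fin: "finite C" "finite C'" using C by (auto simp: sold_out_def is_menu_def C'_def)
  have st: "fst s < fst t" "snd s < snd t"
    using sold_out_order[OF C(1), of s t] C s by auto
  have below: "n \<le> m" if "n \<in> buyers a b C s" for n
    using that C(2) st by (auto simp: buyers_def utility_def m_def field_simps)
  have above: "m \<le> n" if "n \<in> buyers a b C t" for n
    using that s st by (auto simp: buyers_def utility_def m_def field_simps)
  \<comment> \<open>Single crossing: a buyer \<open>l\<close> of \<open>s\<close> lies below every
    buyer of \<open>t\<close>, and \<open>s\<close> has the highest quality left, so its advantage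
    at \<open>l\<close> persists for higher types.\<close>
  have "buyers a b C t \<subseteq> buyers a b C' s"
  proof
    fix n assume n: "n \<in> buyers a b C t"
    obtain l where l: "l \<in> buyers a b C s" "a < l"
      using obtain_interior_buyer fin C s unfolding sold_out_def by (metis DiffD1)
    have "l \<le> n" using above[OF n] below[OF l(1)] by simp
    have "utility n y \<le> utility n s" if "y \<in> C'" for y
    proof -
      have "snd y \<le> snd s"
        using sold_out_order(2)[OF C(1), of y s] s that by (cases "y = s") (auto simp: C'_def)
      then have "(n - l) * snd y \<le> (n - l) * snd s"
        using \<open>l \<le> n\<close> by (intro mult_left_mono) auto
      moreover have "utility l y \<le> utility l s"
        using l that by (auto simp: buyers_def C'_def)
      ultimately show ?thesis by (simp add: utility_def algebra_simps)
    qed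
    moreover have "0 \<le> utility n s"
    proof -
      have "l * snd s \<le> n * snd s"
        using \<open>l \<le> n\<close> sold_out_nonneg(2)[OF C(1), of s] s by (intro mult_right_mono) auto
      then show ?thesis using l by (auto simp: buyers_def utility_def)
    qed
    ultimately show "n \<in> buyers a b C' s" using n by (auto simp: buyers_def)
  qed
  \<comment> \<open>Apart from the null type \<open>m\<close>, the buyers of \<open>s\<close> and of
    \<open>t\<close> are disjoint.\<close>
  then have "measure M (buyers a b C s \<union> (buyers a b C t - {m})) \<le> measure M (buyers a b C' s)"
    using buyers_antimono[of C' C a b s] by (intro finite_measure_mono) (auto simp: C'_def)
  moreover have "measure M (buyers a b C s \<union> (buyers a b C t - {m}))
      = measure M (buyers a b C s) + measure M (buyers a b C t - {m})"
    using above below by (intro finite_measure_Union) force+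
  moreover have "measure M (buyers a b C t) \<le> measure M (buyers a b C t - {m}) + measure M {m}"
    by (rule order_trans[OF finite_measure_mono measure_Un_le]) auto
  ultimately have split: "?D s + ?D t \<le> ?D' s"
    using fin C s atomless by (simp add: demand_eq_measure_buyers C'_def)
  have "measure M (buyers a b C t) \<le> measure M {m..}"
    using above by (intro finite_measure_mono) auto
  then have top: "?D t \<le> 1 - cdf M m"
    using fin C by (simp add: demand_eq_measure_buyers measure_atLeast)
  have "transaction_value M a b C = fst t * ?D t + (\<Sum>x\<in>C'. fst x * ?D x)"
    using fin C by (simp add: transaction_value_def C'_def sum.remove)
  also have "(\<Sum>x\<in>C'. fst x * ?D x) = fst s * ?D s + (\<Sum>x\<in>C' - {s}. fst x * ?D x)"
    using fin s by (simp add: C'_def sum.remove)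
  also have "(\<Sum>x\<in>C' - {s}. fst x * ?D x) \<le> (\<Sum>x\<in>C' - {s}. fst x * ?D' x)"
    using fin sold_out_nonneg[OF C(1)]
    by (intro sum_mono mult_left_mono demand_antimono) (auto simp: C'_def)
  also have "fst s * ?D s \<le> fst s * (?D' s - ?D t)"
    using split sold_out_nonneg[OF C(1), of s] s by (intro mult_left_mono) auto
  also have "fst t * ?D t + (fst s * (?D' s - ?D t) + (\<Sum>x\<in>C' - {s}. fst x * ?D' x))
      = transaction_value M a b C' + (fst t - fst s) * ?D t"
    using fin s by (simp add: transaction_value_def C'_def sum.remove algebra_simps)
  also have "(fst t - fst s) * ?D t \<le> (fst t - fst s) * (1 - cdf M m)"
    using top st by (intro mult_left_mono) auto
  finally show ?thesis by (simp add: C'_def m_def)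
qed

lemma transaction_value_le_top:
  assumes "sold_out C" "t \<in> C" "\<And>x. x \<in> C \<Longrightarrow> fst x \<le> fst t"
  shows "transaction_value M a b C \<le> single_value M t"
  using assms
proof (induction "card C" arbitrary: C t rule: less_induct)
  case less
  note C = less.prems
  have fin: "finite C" using C by (auto simp: sold_out_def is_menu_def)
  have nonneg: "0 \<le> fst x" "0 \<le> snd x" if "x \<in> C" for x
    using sold_out_nonneg[OF C(1) that] .
  show ?case
  proof (cases "C = {t}")
    case True
    have "0 < snd t \<or> t = (0, 0)"
      using sold_out_zero_quality[OF C(1,2)] nonneg[OF C(2)] by (auto simp: prod_eq_iff)
    then show ?thesis using True transaction_value_singleton by simp
  next
    case False
    then have "Max (fst ` (C - {t})) \<in> fst ` (C - {t})"
      using fin C(2) by (intro Max_in) auto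
    then obtain s where s: "s \<in> C - {t}" "fst s = Max (fst ` (C - {t}))" by (metis imageE)
    have "s \<in> C" "s \<noteq> t" "fst s \<le> fst t" using s(1) C(3) by auto
    then have st: "fst s < fst t" "snd s < snd t"
      using sold_out_order[OF C(1) _ C(2)] by auto
    have max: "fst x \<le> fst s" if "x \<in> C - {t}" for x
      using that fin by (simp add: s(2))
    obtain m where m: "m \<in> buyers a b C s" "m < b"
      using obtain_interior_buyer fin C(1) s unfolding sold_out_def by (metis DiffD1)
    obtain n where n: "n \<in> buyers a b C t" "n < b"
      using obtain_interior_buyer fin C unfolding sold_out_def by metis
    \<comment> \<open>Each price per unit is at most a type that actually buys, hence at most
      \<open>b\<close>, as Jensen's inequality requires.\<close>
    have sb: "fst s \<le> snd s * b"
    proof -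
      have "fst s \<le> snd s * m" using m by (auto simp: buyers_def utility_def mult.commute)
      also have "\<dots> \<le> snd s * b" using m nonneg s by (intro mult_left_mono) auto
      finally show ?thesis .
    qed
    have tb: "fst t - fst s \<le> (snd t - snd s) * b"
    proof -
      have "fst t - fst s \<le> (snd t - snd s) * n"
        using n s by (auto simp: buyers_def utility_def algebra_simps)
      also have "\<dots> \<le> (snd t - snd s) * b" using n st by (intro mult_left_mono) auto
      finally show ?thesis .
    qed
    have "transaction_value M a b (C - {t}) \<le> single_value M s"
      using C(2) fin s(1) max
      by (intro less.hyps card_Diff1_less sold_out_subset[OF C(1)]) auto
    then have "transaction_value M a b C \<le> single_value M s
        + (fst t - fst s) * (1 - cdf M ((fst t - fst s) / (snd t - snd s)))"
      using transaction_value_drop_top[OF C s(1) max] by simp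
    also have "\<dots> \<le> single_value M t"
      using single_value_Jensen[of "fst s" "snd s" "fst t" "snd t"]
        sold_out_zero_quality[OF C(1) \<open>s \<in> C\<close>] nonneg[OF \<open>s \<in> C\<close>] st sb tb
      by simp
    finally show ?thesis .
  qed
qed

section \<open>1-separating pairs above a given one\<close>

lemma single_pairs_iff:
  "x \<in> single_pairs M a b \<C> \<longleftrightarrow> {x} \<in> \<C> \<and> 0 < demand M a b {x} x"
  by (simp add: single_pairs_def separating_menus_def positive_menus_def)

lemma single_pairs_sold_out:
  "constraint_set \<C> \<Longrightarrow> x \<in> single_pairs M a b \<C> \<Longrightarrow> sold_out {x}"
  by (auto simp: single_pairs_iff sold_out_def constraint_set_def)

text \<open>The witness \<open>w\<close> is a pair of maximal price or \<open>x\<close> itself.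
  \<open>z\<close> need not be 1-separating, since it will be the top pair of a menu as well as a
  maximizer of the value.\<close>

lemma obtain_single_pair_above:
  assumes menus: "constraint_set \<C>" and regular: "regular M a b \<C>"
    and compact: "compact (single_pairs M a b \<C>)"
    and x: "x \<in> single_pairs M a b \<C>"
  obtains w where "w \<in> single_pairs M a b \<C>" "fst x \<le> fst w" "snd x \<le> snd w"
    "\<And>z. 0 \<le> fst z \<Longrightarrow> 0 \<le> snd z \<Longrightarrow> (snd z = 0 \<Longrightarrow> fst z = 0) \<Longrightarrow>
      fst z \<le> fst x \<Longrightarrow> snd z \<le> snd x \<Longrightarrow> single_value M z \<le> single_value M w"
proof -
  let ?S = "single_pairs M a b \<C>"
  note sold = single_pairs_sold_out[OF menus]
  obtain m where m: "m \<in> {0..b}" "\<And>x. 0 \<le> x \<Longrightarrow> revenue x \<le> revenue m"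
    by (rule obtain_revenue_max) blast
  have "continuous_on ?S fst" by (intro continuous_intros)
  then obtain t where t: "t \<in> ?S" "\<And>y. y \<in> ?S \<Longrightarrow> fst y \<le> fst t"
    using continuous_attains_sup[OF compact] x by (metis empty_iff)
  have tm: "fst t \<le> snd t * m"
  proof (cases "snd t = 0")
    case True
    then show ?thesis using sold_out_zero_quality[OF sold[OF t(1)]] by simp
  next
    case False
    then have "0 < snd t" using sold_out_nonneg(2)[OF sold[OF t(1)]] by simp
    then have "fst t \<le> monopoly_price M (snd t)"
      using regular t unfolding regular_def by (auto simp: split_beta \<open>0 < snd t\<close>)
    then show ?thesis using monopoly_price_le[OF m \<open>0 < snd t\<close>] by simp
  qed
  show thesis
  proof (cases "snd x \<le> snd t")
    case True
    show thesis
      using single_value_mono[OF m, of _ "fst t" "snd t"] tm t(2)[OF x] True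
      by (intro that[of t] t x True) auto
  next
    case False
    then have "snd t * m \<le> snd x * m" using m by (intro mult_right_mono) auto
    then have "fst x \<le> snd x * m" using tm t(2)[OF x] by simp
    then show thesis
      using single_value_mono[OF m, of _ "fst x" "snd x"] by (intro that[of x] x) auto
  qed
qed

end

section \<open>Optimality and maximality\<close>

theorem theorem1:
  fixes a b :: real
    and f :: "real \<Rightarrow> real"
    and M :: "real measure"
    and \<C> :: "(real \<times> real) set set"
  assumes interval: "0 \<le> a" "a < b"
    and density_f: "f \<in> borel_measurable borel" "\<And>x. 0 \<le> f x"
    and M_def: "M = density lborel (\<lambda>x. ennreal (f x))"
    and prob: "prob_space M"
    and supported: "measure M {a..b} = 1"
    and menus: "constraint_set \<C>"
    and convex: "strictly_convex_on {a..b} (\<lambda>m. cdf M m * m)"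
    and regular: "regular M a b \<C>"
    and compact: "compact (single_pairs M a b \<C>)"
    and nonempty: "single_pairs M a b \<C> \<noteq> {}"
    and drop_unsold:
      "\<And>C. C \<in> \<C> \<Longrightarrow> sold_part M a b C \<noteq> {} \<Longrightarrow> sold_part M a b C \<in> \<C>"
  shows "\<exists>p q. (p, q) \<in> single_pairs M a b \<C> \<and> optimal_menu M a b \<C> {(p, q)} \<and>
           (\<forall>(p', q') \<in> single_pairs M a b \<C>. (p', q') \<noteq> (p, q) \<longrightarrow> p' < p \<or> q' < q)"
proof -
  have sets_M: "sets M = sets borel" by (simp add: M_def)
  have "emeasure M {x} = 0" for x
    using density_f unfolding M_def
    by (subst emeasure_density) (auto simp: nn_integral_0_iff_AE intro: AE_I[of _ _ "{x}"])
  then have "measure M {x} = 0" for x by (simp add: measure_def)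
  then interpret type_law M a b
    using prob sets_M interval supported convex
    by (auto simp: type_law_def type_law_axioms_def real_distribution_def real_distribution_axioms_def)
  let ?S = "single_pairs M a b \<C>"
  let ?V = "single_value M"
  note sold = single_pairs_sold_out[OF menus]
  have nonneg: "0 \<le> fst x" "0 \<le> snd x" "snd x = 0 \<Longrightarrow> fst x = 0" if "x \<in> ?S" for x
    using sold_out_nonneg[OF sold[OF that]] sold_out_zero_quality[OF sold[OF that]] by auto
  have cont: "continuous_on ?S ?V"
    using nonneg by (intro continuous_on_single_value) auto
  obtain y where y: "y \<in> ?S" "\<And>x. x \<in> ?S \<Longrightarrow> ?V x \<le> ?V y"
    using continuous_attains_sup[OF compact nonempty cont] by blast
  \<comment> \<open>Ties are broken by the sum of price and quality: a maximizer of the sum over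
    \<open>K\<close> has no other element of \<open>K\<close> above it.\<close>
  define K where "K = {x \<in> ?S. ?V x = ?V y}"
  have "closedin (top_of_set ?S) K"
    unfolding K_def by (rule continuous_closedin_preimage_constant[OF cont])
  then have "compact K" using compact by (rule closedin_compact[rotated])
  moreover have "y \<in> K" using y by (simp add: K_def)
  moreover have "continuous_on K (\<lambda>x. fst x + snd x)" by (intro continuous_intros)
  ultimately obtain z where z: "z \<in> K" "\<And>x. x \<in> K \<Longrightarrow> fst x + snd x \<le> fst z + snd z"
    using continuous_attains_sup[of K "\<lambda>x. fst x + snd x"] by (metis empty_iff)
  have zS: "z \<in> ?S" "?V z = ?V y" using z by (auto simp: K_def)
  have single: "transaction_value M a b {x} = ?V x" if "x \<in> ?S" for x
    using nonneg[OF that] by (intro transaction_value_singleton) (auto simp: prod_eq_iff less_le)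
  have max: "transaction_value M a b C \<le> ?V z" if C: "C \<in> \<C>" for C
  proof -
    have menu: "is_menu C" "finite C" using menus C by (auto simp: constraint_set_def is_menu_def)
    \<comment> \<open>Dropping the unsold pairs loses nothing: their summands are 0 and demand for
      the others can only grow. If anything is left, \<open>drop_unsold\<close> keeps it in
      \<open>\<C>\<close>.\<close>
    define P where "P = sold_part M a b C"
    have P: "P \<subseteq> C" "finite P" using menu by (auto simp: P_def sold_part_def)
    have demand_le: "demand M a b C x \<le> demand M a b P x" if "x \<in> P" for x
      using demand_antimono menu P that by blast
    have "transaction_value M a b C = (\<Sum>x\<in>P. fst x * demand M a b C x)"
      unfolding transaction_value_def using menu
      by (intro sum.mono_neutral_right)
        (auto simp: P_def sold_part_def demand_def not_less measure_le_0_iff)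
    also have "\<dots> \<le> transaction_value M a b P"
      unfolding transaction_value_def
    proof (intro sum_mono mult_left_mono)
      fix x assume "x \<in> P"
      then show "demand M a b C x \<le> demand M a b P x" by (rule demand_le)
      show "0 \<le> fst x" using menu(1) P(1) \<open>x \<in> P\<close> by (auto simp: is_menu_def split_beta)
    qed
    also have "\<dots> \<le> ?V z"
    proof (cases "P = {}")
      case True
      then show ?thesis
        using single_value_bounds(1)[OF nonneg(1)[OF zS(1)]] by (simp add: transaction_value_def)
    next
      case False
      have pos: "0 < demand M a b P x" if "x \<in> P" for x
        using demand_le[OF that] that by (auto simp: P_def sold_part_def)
      have sP: "sold_out P" using menu P pos by (auto simp: sold_out_def is_menu_def)
      have "P \<in> positive_menus M a b \<C>"
        using drop_unsold[OF C] False pos by (simp add: positive_menus_def P_def)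
      have "Max (fst ` P) \<in> fst ` P" using P False by (intro Max_in) auto
      then obtain t where t: "t \<in> P" "fst t = Max (fst ` P)" by (metis imageE)
      have top: "fst x \<le> fst t" if "x \<in> P" for x using that P by (simp add: t(2))
      have "\<exists>x\<in>?S. fst t \<le> fst x \<and> snd t \<le> snd x"
        using regular[unfolded regular_def, THEN conjunct1, rule_format,
            OF \<open>P \<in> positive_menus M a b \<C>\<close> t(1)] top
        by (simp add: split_beta)
      then obtain x where x: "x \<in> ?S" "fst t \<le> fst x" "snd t \<le> snd x" by blast
      obtain w where w: "w \<in> ?S" "?V t \<le> ?V w"
        using obtain_single_pair_above[OF menus regular compact x(1)] x(2,3)
          sold_out_nonneg[OF sP t(1)] sold_out_zero_quality[OF sP t(1)] by metis
      have "transaction_value M a b P \<le> ?V t"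
        using transaction_value_le_top[OF sP t(1) top] .
      also have "\<dots> \<le> ?V z" using w y zS by fastforce
      finally show ?thesis .
    qed
    finally show ?thesis .
  qed
  have "optimal_menu M a b \<C> {z}"
    using max single zS by (auto simp: optimal_menu_def is_arg_max_linorder single_pairs_iff)
  moreover have "fst x < fst z \<or> snd x < snd z" if x: "x \<in> ?S" "x \<noteq> z" for x
  proof (rule ccontr)
    \<comment> \<open>If \<open>x\<close> lies above \<open>z\<close>, some \<open>w\<close> above
      \<open>x\<close> is again in \<open>K\<close>. The sum at \<open>x\<close> is then at most
      that at \<open>z\<close>, which forces \<open>x = z\<close>.\<close>
    assume "\<not> ?thesis"
    then have le: "fst z \<le> fst x" "snd z \<le> snd x" by auto
    obtain w where w: "w \<in> ?S" "fst x \<le> fst w" "snd x \<le> snd w" "?V z \<le> ?V w"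
      using obtain_single_pair_above[OF menus regular compact x(1)] le nonneg[OF zS(1)] by metis
    then have "w \<in> K" using y(2)[of w] zS by (simp add: K_def)
    then have "fst x + snd x \<le> fst z + snd z" using z(2) w by fastforce
    then show False using le x(2) by (auto simp: prod_eq_iff)
  qed
  ultimately show ?thesis using zS by (cases z) fastforce
qed

end
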